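(* For every pair of integers $g\ge 3$ and $k\ge 1$, there exists a (finite) grounded square box graph with girth at least $g$ and chromatic number at least $k$.
   Context: An axis-aligned box in $\mathbb{R}^3$ is a set of the form $[a_1,b_1]\times[a_2,b_2]\times[a_3,b_3]$ with real numbers $a_i\le b_i$. It is a square box if its top and bottom faces (the faces orthogonal to the $z$-axis) are squares, i.e. $b_1-a_1=b_2-a_2$. Let $P_{x=y}=\{(x,y,z)\in\mathbb{R}^3 : x=y\}$. A square box $B\subset\mathbb{R}^3$ is grounded if $B\cap P_{x=y}\neq\emptyset$ and every point $(x,y,z)\in B$ satisfies $x\ge y$. The intersection graph of a collection of sets is the simple graph whose vertices are the sets of the collection, two distinct sets being adjacent if and only if they have non-empty intersection. A graph is a grounded square box graph if it is the intersection graph of a (finite) collection of grounded square boxes. The girth of a graph is the length of its shortest cycle ($\infty$ if the graph has no cycle). *)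

theory Defs
  imports Complex_Main "HOL-Library.Extended_Nat"
begin

(* A graph is given by its vertex set and its set of edges, each edge being a two-element set. *)
type_synonym 'a graph = "'a set \<times> 'a set set"

abbreviation verts :: "'a graph \<Rightarrow> 'a set" where
  "verts G \<equiv> fst G"

abbreviation edges :: "'a graph \<Rightarrow> 'a set set" where
  "edges G \<equiv> snd G"

(* The vertices are listed once each; the index modulo the length closes the cycle. *)
definition is_cycle :: "'a graph \<Rightarrow> 'a list \<Rightarrow> bool" where
  "is_cycle G vs \<longleftrightarrow>
     3 \<le> length vs \<and> distinct vs \<and> set vs \<subseteq> verts G \<and>
     (\<forall>i<length vs. {vs ! i, vs ! (Suc i mod length vs)} \<in> edges G)"

(* The infimum of the empty set in enat is infinity, the girth of an acyclic graph. *)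
definition girth :: "'a graph \<Rightarrow> enat" where
  "girth G = (INF vs \<in> {vs. is_cycle G vs}. enat (length vs))"

definition proper_coloring :: "'a graph \<Rightarrow> nat \<Rightarrow> ('a \<Rightarrow> nat) \<Rightarrow> bool" where
  "proper_coloring G n c \<longleftrightarrow>
     (\<forall>v\<in>verts G. c v < n) \<and>
     (\<forall>u\<in>verts G. \<forall>v\<in>verts G. {u, v} \<in> edges G \<longrightarrow> c u \<noteq> c v)"

definition chromatic_number :: "'a graph \<Rightarrow> enat" where
  "chromatic_number G = (INF n \<in> {n. \<exists>c. proper_coloring G n c}. enat n)"

definition intersection_graph :: "'a set set \<Rightarrow> 'a set graph" where
  "intersection_graph C =
     (C, {{A, B} | A B. A \<in> C \<and> B \<in> C \<and> A \<noteq> B \<and> A \<inter> B \<noteq> {}})"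

definition square_box :: "(real \<times> real \<times> real) set \<Rightarrow> bool" where
  "square_box B \<longleftrightarrow>
     (\<exists>a1 b1 a2 b2 a3 b3. a1 \<le> b1 \<and> a2 \<le> b2 \<and> a3 \<le> b3 \<and>
        B = {a1..b1} \<times> {a2..b2} \<times> {a3..b3} \<and> b1 - a1 = b2 - a2)"

definition diagonal_plane :: "(real \<times> real \<times> real) set" where
  "diagonal_plane = {(x, y, z). x = y}"

definition grounded_square_box :: "(real \<times> real \<times> real) set \<Rightarrow> bool" where
  "grounded_square_box B \<longleftrightarrow>
     square_box B \<and> B \<inter> diagonal_plane \<noteq> {} \<and> (\<forall>(x, y, z)\<in>B. x \<ge> y)"

definition grounded_square_box_graph :: "(real \<times> real \<times> real) set graph \<Rightarrow> bool" where
  "grounded_square_box_graph G \<longleftrightarrow>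
     (\<exists>C. finite C \<and> (\<forall>B\<in>C. grounded_square_box B) \<and> G = intersection_graph C)"

end

theory Submission
  imports Defs "HOL-Library.Nat_Bijection"
begin

text \<open>
  The construction follows Tutte and Descartes: given a representation of a \<open>k\<close>-uncolourable graph
  on a finite set \<open>V\<close> of positions on the line \<open>x = y\<close>, take a sparse hypergraph whose vertices are
  points of the line, whose edges are approximately homothetic to \<open>V\<close>, and which has a monochromatic
  edge in every \<open>(k + 1)\<close>-colouring. Each point becomes a tall box with a tiny base, and over each
  edge a scaled copy of the old representation is placed at a height of its own, every box of the
  copy meeting exactly one tall box. Since copies need only be approximately homothetic, the
  hypergraph without the sparseness condition comes from an elementary clustering argument;
  sparseness is then obtained by the partite construction of Nesetril and Roedl.
\<close>

text \<open>Girth enters only as a leaf condition on small sets of vertices or hyperedges. Leaves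
  survive gluing if they can be kept away from the one point where a piece is attached to the rest,
  which is why both leaf conditions get a rooted form. Grounded boxes meet only if their base points
  are within the smaller side length of each other. A tall box with a tiny base therefore meets, at
  every height, just those larger boxes whose base points nearly coincide with its own, so it can
  serve as a vertex shared by many copies. The price is that each hyperedge must have the shape of
  the old representation, so an arbitrary sparse Ramsey hypergraph is of no use. The partite
  construction keeps these shapes under projection, but may put several vertices over one real
  point. Positions are perturbed afterwards, and the strictness of all contacts pays for this as
  well as for the inexact homothety.\<close>

section \<open>Sparse Ramsey hypergraphs\<close>

text \<open>Equivalently, there is no Berge cycle of length at most \<open>m\<close>: an edge of such a cycle meets the
  union of the others in two points, and a family without cycles has a leaf.\<close>
definition sparse :: "nat \<Rightarrow> 'a set set \<Rightarrow> bool" where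
  "sparse m E \<longleftrightarrow>
     (\<forall>S\<subseteq>E. S \<noteq> {} \<longrightarrow> finite S \<longrightarrow> card S \<le> m \<longrightarrow> (\<exists>e\<in>S. \<exists>p. e \<inter> \<Union>(S - {e}) \<subseteq> {p}))"

definition ramsey :: "nat \<Rightarrow> 'a set set \<Rightarrow> bool" where
  "ramsey n E \<longleftrightarrow> (\<forall>c :: 'a \<Rightarrow> nat. (\<forall>v. c v < n) \<longrightarrow> (\<exists>e\<in>E. \<exists>a. \<forall>v\<in>e. c v = a))"

text \<open>If the leaf \<open>e\<close> contains \<open>q\<close>, remove it and recurse with its
  only contact point \<open>p\<close> as the new root. The edge found then meets \<open>e\<close> at
  most in \<open>p\<close>, which the root already accounts for, so putting \<open>e\<close> (and
  with it \<open>q\<close>) back costs nothing.\<close>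

lemma sparse_rooted:
  assumes "sparse m E" "S \<subseteq> E" "S \<noteq> {}" "finite S" "card S \<le> m"
  shows "\<exists>e\<in>S. \<exists>p. e \<inter> (\<Union>(S - {e}) \<union> {q}) \<subseteq> {p}"
  using assms(2-5)
proof (induction "card S" arbitrary: S q rule: less_induct)
  case less
  obtain e p where e: "e \<in> S" "e \<inter> \<Union>(S - {e}) \<subseteq> {p}"
    using assms(1) less.prems unfolding sparse_def by meson
  consider "q \<notin> e" | "q \<in> e" "S = {e}" | "q \<in> e" "S \<noteq> {e}" by blast
  then show ?case
  proof cases
    case 1
    then have "e \<inter> (\<Union>(S - {e}) \<union> {q}) \<subseteq> {p}" using e by blast
    then show ?thesis using e(1) by blast
  next
    case 2
    then show ?thesis by auto
  next
    case 3
    have lt: "card (S - {e}) < card S" using e less.prems by (meson card_Diff1_less)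
    have "S - {e} \<subseteq> E" "S - {e} \<noteq> {}" "finite (S - {e})" "card (S - {e}) \<le> m"
      using 3 e lt less.prems by auto
    from less.hyps[OF lt this, of p] obtain e' p' where
      e': "e' \<in> S - {e}" "e' \<inter> (\<Union>(S - {e} - {e'}) \<union> {p}) \<subseteq> {p'}"
      by blast
    have "x \<in> {p'}" if x: "x \<in> e'" "x \<in> \<Union>(S - {e'}) \<union> {q}" for x
    proof (cases "x \<in> e")
      case True
      then have "x = p" using e(2) e'(1) x(1) by blast
      then show ?thesis using e'(2) x(1) by blast
    next
      case False
      then have "x \<in> \<Union>(S - {e} - {e'})" using x(2) 3(1) by blast
      then show ?thesis using e'(2) x(1) by blast
    qed
    then have "e' \<inter> (\<Union>(S - {e'}) \<union> {q}) \<subseteq> {p'}" by (metis IntE subsetI)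
    moreover have "e' \<in> S" using e'(1) by simp
    ultimately show ?thesis by (intro bexI[of _ e'] exI[of _ p'])
  qed
qed

section \<open>The partite construction\<close>

definition partite :: "'a set set \<Rightarrow> nat set set \<Rightarrow> (nat \<Rightarrow> 'a) \<Rightarrow> bool" where
  "partite F E \<pi> \<longleftrightarrow> finite E \<and> (\<forall>e\<in>E. finite e \<and> inj_on \<pi> e \<and> \<pi> ` e \<in> F)"

text \<open>The fibres of \<open>\<pi>\<close> over \<open>J\<close> are the parts on which
  colourings must still be constant. The construction starts with all parts constrained and releases
  them one at a time.\<close>

definition ramsey_const_on :: "nat \<Rightarrow> 'a set \<Rightarrow> nat set set \<Rightarrow> (nat \<Rightarrow> 'a) \<Rightarrow> bool" where
  "ramsey_const_on n J E \<pi> \<longleftrightarrow>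
     (\<forall>c :: nat \<Rightarrow> nat. (\<forall>v. c v < n) \<longrightarrow>
        (\<forall>u\<in>\<Union>E. \<forall>v\<in>\<Union>E. \<pi> u = \<pi> v \<longrightarrow> \<pi> u \<in> J \<longrightarrow> c u = c v) \<longrightarrow>
        (\<exists>e\<in>E. \<exists>a. \<forall>v\<in>e. c v = a))"

text \<open>The \<open>i\<close>-th part of \<open>E\<close> is identified with each edge of \<open>H\<close> in turn, using disjoint copies of
  the rest of \<open>E\<close>. An edge meets the \<open>i\<close>-th part at most once, so a cycle through several copies
  is longer than the cycle that it traces in \<open>H\<close>; hence \<open>H\<close> may be less sparse than \<open>E\<close>.\<close>
lemma partite_amalgamation:
  fixes E H :: "nat set set" and \<pi> :: "nat \<Rightarrow> 'a"
  assumes P: "partite F E \<pi>" and spE: "sparse (Suc m) E" and ram: "ramsey_const_on n J E \<pi>"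
    and H: "finite H" "\<forall>h\<in>H. finite h \<and> card h = card {v \<in> \<Union>E. \<pi> v = i}" "sparse m H" "ramsey n H"
  shows "\<exists>E' \<pi>'. partite F E' \<pi>' \<and> sparse (Suc m) E' \<and> ramsey_const_on n (J - {i}) E' \<pi>'"
proof -
  let ?A = "{v \<in> \<Union>E. \<pi> v = i}"
  have finA: "finite ?A" using P unfolding partite_def by auto
  have "\<exists>f. bij_betw f ?A h" if "h \<in> H" for h
    using that H(2) finA by (metis (no_types, lifting) finite_same_card_bij)
  then obtain \<psi> where \<psi>: "\<And>h. h \<in> H \<Longrightarrow> bij_betw (\<psi> h) ?A h" by metis
  \<comment> \<open>Part \<open>i\<close> goes into a shared summand through
    \<open>\<psi> h\<close>; other points carry the code of \<open>h\<close>, so distinct copies can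
    meet only in part \<open>i\<close>. The code is injective because the edges of \<open>H\<close>
    are finite.\<close>
  define emb where "emb h v = (if \<pi> v = i then sum_encode (Inl (\<psi> h v))
      else sum_encode (Inr (prod_encode (set_encode h, v))))" for h v
  define \<pi>' where "\<pi>' w = (case sum_decode w of Inl _ \<Rightarrow> i | Inr q \<Rightarrow> \<pi> (snd (prod_decode q)))" for w
  have \<pi>'emb: "\<pi>' (emb h v) = \<pi> v" for h v
    unfolding \<pi>'_def emb_def by auto
  have emb_eq: "(\<pi> v \<noteq> i \<and> h = h' \<and> v = v') \<or> (\<pi> v = i \<and> \<pi> v' = i \<and> \<psi> h v = \<psi> h' v')"
    if "emb h v = emb h' v'" "h \<in> H" "h' \<in> H" for h h' v v'
    using that H(2) unfolding emb_def
    by (auto simp: sum_encode_eq prod_encode_eq set_encode_eq split: if_splits)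
  have emb_inj: "v = v'" if "emb h v = emb h v'" "h \<in> H" "v \<in> \<Union>E" "v' \<in> \<Union>E" for h v v'
    using emb_eq[OF that(1,2,2)] \<psi>[OF that(2)] that(3,4) unfolding bij_betw_def inj_on_def by blast
  define E' where "E' = (\<lambda>(h, f). emb h ` f) ` (H \<times> E)"
  have part': "partite F E' \<pi>'"
    unfolding partite_def
  proof (intro conjI ballI)
    show "finite E'" unfolding E'_def using P H(1) unfolding partite_def by simp
    fix e assume "e \<in> E'"
    then obtain h f where e: "e = emb h ` f" "f \<in> E" unfolding E'_def by auto
    show "finite e" "inj_on \<pi>' e" "\<pi>' ` e \<in> F"
      using P e unfolding partite_def by (auto simp: image_image \<pi>'emb inj_on_def)
  qed
  have sp': "sparse (Suc m) E'"
    unfolding sparse_def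
  proof (intro allI impI)
    fix S assume S: "S \<subseteq> E'" "S \<noteq> {}" "finite S" "card S \<le> Suc m"
    have "\<forall>e\<in>S. \<exists>h f. h \<in> H \<and> f \<in> E \<and> e = emb h ` f" using S(1) unfolding E'_def by blast
    then obtain hh ff where hf: "\<And>e. e \<in> S \<Longrightarrow> hh e \<in> H \<and> ff e \<in> E \<and> e = emb (hh e) ` ff e" by metis
    \<comment> \<open>Either at most \<open>m\<close> copies are involved and \<open>H\<close>
      provides a leaf among them, or \<open>S\<close> consists of exactly one edge in each of
      \<open>m + 1\<close> copies.\<close>
    let ?K = "hh ` S"
    show "\<exists>e\<in>S. \<exists>p. e \<inter> \<Union>(S - {e}) \<subseteq> {p}"
    proof (cases "card ?K \<le> m")
      case True
      have "?K \<subseteq> H" "?K \<noteq> {}" "finite ?K" using hf S by auto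
      then obtain h y where h: "h \<in> ?K" "h \<inter> \<Union>(?K - {h}) \<subseteq> {y}"
        using H(3) True unfolding sparse_def by meson
      have hH: "h \<in> H" using h hf by auto
      define T where "T = ff ` {e \<in> S. hh e = h}"
      have T: "T \<subseteq> E" "T \<noteq> {}" "finite T" using h hf S unfolding T_def by auto
      have "card T \<le> card {e \<in> S. hh e = h}" unfolding T_def using S by (simp add: card_image_le)
      also have "\<dots> \<le> card S" using S by (intro card_mono) auto
      finally have "card T \<le> Suc m" using S by simp
      \<comment> \<open>The leaf copy meets the other copies only in \<open>y\<close>. With the
        preimage of \<open>y\<close> as root, the contacts of \<open>f\<close> inside the copy and
        those outside it fall on the same point.\<close>
      from sparse_rooted[OF spE T this, of "inv_into ?A (\<psi> h) y"] obtain f p where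
        f: "f \<in> T" "f \<inter> (\<Union>(T - {f}) \<union> {inv_into ?A (\<psi> h) y}) \<subseteq> {p}" by blast
      then obtain e where e: "e \<in> S" "hh e = h" "ff e = f" unfolding T_def by auto
      have ee: "e = emb h ` f" using hf[OF e(1)] e by simp
      have "w = emb h p" if w: "w \<in> e" "w \<in> e'" "e' \<in> S" "e' \<noteq> e" for w e'
      proof -
        obtain v where v: "v \<in> f" "w = emb h v" using w(1) ee by auto
        have fE: "f \<in> E" using f T by auto
        obtain v' where v': "v' \<in> ff e'" "w = emb (hh e') v'" using w(2) hf[OF w(3)] by auto
        have fe': "hh e' \<in> H" "ff e' \<in> E" using hf[OF w(3)] by auto
        show ?thesis
        proof (cases "hh e' = h")
          case hh: True
          then have "v = v'" using v v' emb_inj[OF _ hH] fE fe' by (metis UnionI)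
          moreover have "ff e' \<in> T" "ff e' \<noteq> f"
            using w ee hf[OF w(3)] hh unfolding T_def by auto
          ultimately have "v = p" using f(2) v v' by blast
          then show ?thesis using v by simp
        next
          case hh: False
          then have vv: "\<pi> v = i" "\<pi> v' = i" "\<psi> h v = \<psi> (hh e') v'"
            using emb_eq[of h v "hh e'" v'] v v' hH fe' by auto
          have vA: "v \<in> ?A" using vv v fE by auto
          have "\<psi> h v \<in> h" using \<psi>[OF hH] vA by (auto simp: bij_betw_def)
          moreover have "\<psi> h v \<in> hh e'"
            using \<psi>[OF fe'(1)] vv v' fe' by (auto simp: bij_betw_def)
          ultimately have "\<psi> h v = y" using h(2) hh w(3) by blast
          then have "inv_into ?A (\<psi> h) y = v"
            using \<psi>[OF hH] vA by (metis (no_types, lifting) bij_betw_inv_into_left)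
          then have "v = p" using f(2) v by blast
          then show ?thesis using v by simp
        qed
      qed
      then have "e \<inter> \<Union>(S - {e}) \<subseteq> {emb h p}" by blast
      then show ?thesis using e(1) by blast
    next
      case False
      then have "card ?K = card S" using S card_image_le[of S hh] by linarith
      then have inj: "inj_on hh S" using S eq_card_imp_inj_on by blast
      \<comment> \<open>Any edge will do: edges of \<open>S\<close> now lie in distinct copies and
        meet only in part \<open>i\<close>, which \<open>e\<close> hits at most once since
        \<open>\<pi>\<close> is injective on it.\<close>
      obtain e where e: "e \<in> S" using S by blast
      have injf: "inj_on \<pi> (ff e)" using hf[OF e] P unfolding partite_def by auto
      have key: "\<exists>v\<in>ff e. \<pi> v = i \<and> w = emb (hh e) v"
        if w: "w \<in> e" "w \<in> e'" "e' \<in> S" "e' \<noteq> e" for w e'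
      proof -
        obtain v where v: "v \<in> ff e" "w = emb (hh e) v" using w(1) hf[OF e] by auto
        obtain v' where v': "v' \<in> ff e'" "w = emb (hh e') v'" using w(2) hf[OF w(3)] by auto
        have "hh e \<noteq> hh e'" using inj_onD[OF inj _ e w(3)] w(4) by auto
        then have "\<pi> v = i" using emb_eq[of "hh e" v "hh e'" v'] v v' hf[OF e] hf[OF w(3)] by auto
        then show ?thesis using v by auto
      qed
      have "w = w'" if ww: "w \<in> e \<inter> \<Union>(S - {e})" "w' \<in> e \<inter> \<Union>(S - {e})" for w w'
      proof -
        obtain e1 e2 where "w \<in> e" "w \<in> e1" "e1 \<in> S" "e1 \<noteq> e" "w' \<in> e" "w' \<in> e2" "e2 \<in> S" "e2 \<noteq> e"
          using ww by auto
        then obtain v v' where v: "v \<in> ff e" "\<pi> v = i" "w = emb (hh e) v"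
          and v': "v' \<in> ff e" "\<pi> v' = i" "w' = emb (hh e) v'"
          using key[of w e1] key[of w' e2] by auto
        have "v = v'" using v v' injf by (simp add: inj_on_def)
        then show ?thesis using v v' by simp
      qed
      then have "\<exists>p. e \<inter> \<Union>(S - {e}) \<subseteq> {p}" by (metis (no_types, lifting) singletonI subsetI)
      then show ?thesis using e by blast
    qed
  qed
  have "ramsey_const_on n (J - {i}) E' \<pi>'"
    unfolding ramsey_const_on_def
  proof (intro allI impI)
    fix c :: "nat \<Rightarrow> nat"
    assume c: "\<forall>v. c v < n"
      and cc: "\<forall>u\<in>\<Union>E'. \<forall>v\<in>\<Union>E'. \<pi>' u = \<pi>' v \<longrightarrow> \<pi>' u \<in> J - {i} \<longrightarrow> c u = c v"
    \<comment> \<open>A monochromatic \<open>h\<close> selects a copy whose part \<open>i\<close>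
      has one colour. Pulled back along \<open>emb h\<close>, the colouring thus regains the
      constancy on part \<open>i\<close> that \<open>ram\<close> demands.\<close>
    have "\<exists>h\<in>H. \<exists>a. \<forall>v\<in>h. c (sum_encode (Inl v)) = a"
      using H(4) c unfolding ramsey_def by simp
    then obtain h a where h: "h \<in> H" "\<forall>v\<in>h. c (sum_encode (Inl v)) = a" by blast
    have const: "c (emb h u) = c (emb h v)"
      if "u \<in> \<Union>E" "v \<in> \<Union>E" "\<pi> u = \<pi> v" "\<pi> u \<in> J" for u v
    proof (cases "\<pi> u = i")
      case True
      then have "\<psi> h u \<in> h" "\<psi> h v \<in> h" using \<psi>[OF h(1)] that by (auto simp: bij_betw_def)
      then show ?thesis using h(2) that(3) True unfolding emb_def by simp
    next
      case False
      have "emb h u \<in> \<Union>E'" "emb h v \<in> \<Union>E'" using that h(1) unfolding E'_def by auto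
      then show ?thesis
        using cc[rule_format, of "emb h u" "emb h v"] that False unfolding \<pi>'emb by blast
    qed
    have "\<exists>f\<in>E. \<exists>a. \<forall>v\<in>f. c (emb h v) = a"
      using ram[unfolded ramsey_const_on_def, rule_format, of "\<lambda>v. c (emb h v)"] c const by blast
    then obtain f b where f: "f \<in> E" "\<forall>v\<in>f. c (emb h v) = b" by blast
    then have "emb h ` f \<in> E'" "\<forall>w\<in>emb h ` f. c w = b" using h(1) unfolding E'_def by auto
    then show "\<exists>e\<in>E'. \<exists>a. \<forall>v\<in>e. c v = a" by blast
  qed
  then show ?thesis using part' sp' by blast
qed

text \<open>Parts are amalgamated one by one over \<open>\<Union>F\<close>. The size of a part is
  known only after the earlier amalgamations, hence the demand for an \<open>H\<close> of every edge
  size \<open>r\<close>.\<close>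

lemma sparse_ramsey_step:
  fixes F :: "'a set set"
  assumes F: "finite F" "\<forall>f\<in>F. finite f" "ramsey n F"
    and H: "\<And>r. \<exists>H :: nat set set. finite H \<and> (\<forall>h\<in>H. finite h \<and> card h = r) \<and> sparse m H \<and> ramsey n H"
  shows "\<exists>E \<pi>. partite F E \<pi> \<and> sparse (Suc m) E \<and> ramsey n E"
proof -
  have "\<exists>E \<pi>. partite F E \<pi> \<and> sparse (Suc m) E \<and> ramsey_const_on n (- I) E \<pi>" if "finite I" for I
    using that
  proof (induction I rule: finite_induct)
    case empty
    obtain code :: "'a set \<Rightarrow> nat" where code: "inj_on code F"
      using finite_imp_inj_to_nat_seg[OF F(1)] by auto
    have finU: "finite (\<Union>F)" using F by auto
    obtain vc :: "'a \<Rightarrow> nat" where vc: "inj_on vc (\<Union>F)"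
      using finite_imp_inj_to_nat_seg[OF finU] by auto
    \<comment> \<open>Pairwise disjoint copies of the edges of \<open>F\<close> form no cycle at
      all, and a colouring constant on every part is just a colouring of \<open>F\<close>.\<close>
    define E where "E = (\<lambda>f. (\<lambda>v. prod_encode (code f, vc v)) ` f) ` F"
    define \<pi> where "\<pi> w = inv_into (\<Union>F) vc (snd (prod_decode w))" for w
    have \<pi>: "\<pi> (prod_encode (x, vc v)) = v" if "v \<in> \<Union>F" for x v
      unfolding \<pi>_def using vc that by simp
    have \<pi>im: "\<pi> ` (\<lambda>v. prod_encode (code f, vc v)) ` f = f" if "f \<in> F" for f
    proof -
      have "\<pi> (prod_encode (code f, vc v)) = v" if "v \<in> f" for v using \<pi> that \<open>f \<in> F\<close> by blast
      then show ?thesis by (simp add: image_image)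
    qed
    have "inj_on \<pi> ((\<lambda>v. prod_encode (code f, vc v)) ` f)" if "f \<in> F" for f
      using \<pi> that by (auto simp: inj_on_def) (metis UnionI \<pi>)
    then have "partite F E \<pi>"
      unfolding partite_def E_def using F \<pi>im by auto
    moreover have "sparse (Suc m) E"
      unfolding sparse_def
    proof (intro allI impI)
      fix S assume S: "S \<subseteq> E" "S \<noteq> {}"
      then obtain e where e: "e \<in> S" by blast
      have "e \<inter> e' = {}" if e': "e' \<in> S" "e' \<noteq> e" for e'
      proof -
        obtain f f' where f: "f \<in> F" "e = (\<lambda>v. prod_encode (code f, vc v)) ` f"
          "f' \<in> F" "e' = (\<lambda>v. prod_encode (code f', vc v)) ` f'"
          using subsetD[OF S(1) e] subsetD[OF S(1) e'(1)] unfolding E_def by (elim imageE) simp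
        then have "code f \<noteq> code f'" using e'(2) inj_onD[OF code] by blast
        then show ?thesis using f by (auto simp: prod_encode_eq)
      qed
      then have "e \<inter> \<Union>(S - {e}) \<subseteq> {0}" by blast
      then show "\<exists>e\<in>S. \<exists>p. e \<inter> \<Union>(S - {e}) \<subseteq> {p}" using e by blast
    qed
    moreover have "ramsey_const_on n (- {}) E \<pi>"
      unfolding ramsey_const_on_def
    proof (intro allI impI)
      fix c :: "nat \<Rightarrow> nat"
      assume c: "\<forall>v. c v < n"
        and cc: "\<forall>u\<in>\<Union>E. \<forall>v\<in>\<Union>E. \<pi> u = \<pi> v \<longrightarrow> \<pi> u \<in> - {} \<longrightarrow> c u = c v"
      \<comment> \<open>Where \<open>a\<close> has no preimage the choice is arbitrary, but its
        colour is still below \<open>n\<close>.\<close>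
      define c' where "c' a = c (SOME v. v \<in> \<Union>E \<and> \<pi> v = a)" for a
      have "\<forall>a. c' a < n" unfolding c'_def using c by blast
      then obtain f a where f: "f \<in> F" "\<forall>v\<in>f. c' v = a" using F(3) unfolding ramsey_def by meson
      let ?e = "(\<lambda>v. prod_encode (code f, vc v)) ` f"
      have eE: "?e \<in> E" unfolding E_def using f by blast
      have "c w = a" if w: "w \<in> ?e" for w
      proof -
        have wE: "w \<in> \<Union>E" using w eE by blast
        have "(SOME v. v \<in> \<Union>E \<and> \<pi> v = \<pi> w) \<in> \<Union>E \<and> \<pi> (SOME v. v \<in> \<Union>E \<and> \<pi> v = \<pi> w) = \<pi> w"
          by (rule someI[of _ w]) (use wE in blast)
        then have "c w = c' (\<pi> w)" unfolding c'_def using cc wE by (metis Compl_iff empty_iff)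
        moreover have "\<pi> w \<in> f" using \<pi>im[OF f(1)] w by blast
        ultimately show ?thesis using f(2) by simp
      qed
      then show "\<exists>e\<in>E. \<exists>a. \<forall>v\<in>e. c v = a" by (intro bexI[OF _ eE] exI[of _ a] ballI)
    qed
    ultimately show ?case by blast
  next
    case (insert i I)
    then obtain E \<pi> where E: "partite F E \<pi>" "sparse (Suc m) E" "ramsey_const_on n (- I) E \<pi>" by blast
    obtain H :: "nat set set" where "finite H" "\<forall>h\<in>H. finite h \<and> card h = card {v \<in> \<Union>E. \<pi> v = i}"
      "sparse m H" "ramsey n H" using H by blast
    from partite_amalgamation[OF E this] show ?case
      by (simp add: Compl_insert)
  qed
  moreover have "finite (\<Union>F)" using F by auto
  ultimately obtain E \<pi> where E: "partite F E \<pi>" "sparse (Suc m) E" "ramsey_const_on n (- \<Union>F) E \<pi>"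
    by blast
  have "\<pi> v \<in> \<Union>F" if "v \<in> \<Union>E" for v using that E(1) unfolding partite_def by blast
  then have "ramsey n E" using E(3) unfolding ramsey_const_on_def ramsey_def
    by (metis (no_types, lifting) ComplD)
  then show ?thesis using E by blast
qed

lemma ramsey_complete: "ramsey n {h. h \<subseteq> {..<n * r + 1} \<and> card h = r}"
  unfolding ramsey_def
proof (intro allI impI)
  fix c :: "nat \<Rightarrow> nat" assume c: "\<forall>v. c v < n"
  let ?N = "{..<n * r + 1}"
  have "\<exists>a. r \<le> card {v \<in> ?N. c v = a}"
  proof (rule ccontr)
    assume "\<not> ?thesis"
    then have lt: "card {v \<in> ?N. c v = a} \<le> r" for a by (metis linorder_le_cases)
    have "?N \<subseteq> (\<Union>a<n. {v \<in> ?N. c v = a})"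
    proof
      fix v assume "v \<in> ?N"
      then show "v \<in> (\<Union>a<n. {v \<in> ?N. c v = a})" using c by (intro UN_I[of "c v"]) simp_all
    qed
    then have "card ?N \<le> card (\<Union>a<n. {v \<in> ?N. c v = a})" by (intro card_mono) simp_all
    also have "\<dots> \<le> (\<Sum>a<n. card {v \<in> ?N. c v = a})" by (rule card_UN_le) simp
    also have "\<dots> \<le> (\<Sum>a<n. r)" using lt by (intro sum_mono) auto
    finally show False by simp
  qed
  then obtain a where "r \<le> card {v \<in> ?N. c v = a}" ..
  then obtain h where "h \<subseteq> {v \<in> ?N. c v = a}" "card h = r"
    using obtain_subset_with_card_n by metis
  then show "\<exists>h\<in>{h. h \<subseteq> ?N \<and> card h = r}. \<exists>a. \<forall>v\<in>h. c v = a"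
    by (intro bexI[of _ h] exI[of _ a]) auto
qed

text \<open>Each step starts again from the complete \<open>r\<close>-uniform hypergraph and
  amalgamates along hypergraphs of the previous level with other edge sizes, so \<open>r\<close>
  must vary in the induction. Edges keep their size because \<open>\<pi>\<close> is injective on
  them.\<close>

lemma sparse_ramsey_uniform:
  "\<exists>H :: nat set set. finite H \<and> (\<forall>h\<in>H. finite h \<and> card h = r) \<and> sparse m H \<and> ramsey n H"
proof (induction m arbitrary: r)
  case 0
  let ?H = "{h. h \<subseteq> {..<n * r + 1} \<and> card h = r}"
  have "finite ?H" by (rule finite_subset[of _ "Pow {..<n * r + 1}"]) auto
  moreover have "sparse 0 ?H" unfolding sparse_def by auto
  moreover have "\<forall>h\<in>?H. finite h \<and> card h = r" by (auto intro: finite_subset)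
  ultimately show ?case using ramsey_complete[of n r] by blast
next
  case (Suc m)
  let ?F = "{h. h \<subseteq> {..<n * r + 1} \<and> card h = r}"
  have "finite ?F" by (rule finite_subset[of _ "Pow {..<n * r + 1}"]) auto
  moreover have "\<forall>h\<in>?F. finite h" by (auto intro: finite_subset)
  ultimately have "\<exists>E (\<pi> :: nat \<Rightarrow> nat). partite ?F E \<pi> \<and> sparse (Suc m) E \<and> ramsey n E"
    by (rule sparse_ramsey_step[OF _ _ ramsey_complete Suc.IH])
  then obtain E and \<pi> :: "nat \<Rightarrow> nat"
    where E: "partite ?F E \<pi>" "sparse (Suc m) E" "ramsey n E"
    by blast
  have "finite e \<and> card e = r" if "e \<in> E" for e
  proof -
    have "finite e" "inj_on \<pi> e" "card (\<pi> ` e) = r" using E(1) that unfolding partite_def by auto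
    then show ?thesis by (simp add: card_image)
  qed
  moreover have "finite E" using E(1) unfolding partite_def by simp
  ultimately show ?case using E(2,3) by blast
qed

theorem sparse_ramsey:
  fixes F :: "'a set set"
  assumes "finite F" "\<forall>f\<in>F. finite f" "ramsey n F"
  shows "\<exists>E \<pi>. partite F E \<pi> \<and> sparse (Suc m) E \<and> ramsey n E"
  using sparse_ramsey_step[OF assms sparse_ramsey_uniform] .


section \<open>Attaching copies of a graph to a hypergraph\<close>

text \<open>No subgraph with fewer than \<open>g\<close> vertices has minimum degree at least two; in particular there
  is no cycle shorter than \<open>g\<close>.\<close>
definition locally_sparse :: "nat \<Rightarrow> 'a set \<Rightarrow> ('a \<Rightarrow> 'a \<Rightarrow> bool) \<Rightarrow> bool" where
  "locally_sparse g A adj \<longleftrightarrow>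
     (\<forall>W\<subseteq>A. W \<noteq> {} \<longrightarrow> finite W \<longrightarrow> card W < g \<longrightarrow> (\<exists>w\<in>W. \<exists>p. \<forall>y\<in>W. adj w y \<longrightarrow> y = p))"

text \<open>If the leaf found is \<open>q\<close> with neighbour \<open>p\<close>, delete
  \<open>q\<close> and recurse with root \<open>p\<close>. A vertex found other than
  \<open>p\<close> is not adjacent to \<open>q\<close>; if \<open>p\<close> itself is found, it is
  isolated there and regains only \<open>q\<close>. Isolated vertices must be allowed, as
  \<open>W\<close> may be \<open>{q}\<close>.\<close>

lemma locally_sparse_rooted:
  assumes "locally_sparse g A adj" and sym: "\<And>x y. adj x y \<Longrightarrow> adj y x" and irr: "\<And>x. \<not> adj x x"
    and "W \<subseteq> A" "W \<noteq> {}" "finite W" "card W < g"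
  shows "\<exists>w\<in>W. (w \<noteq> q \<and> (\<exists>p. \<forall>y\<in>W. adj w y \<longrightarrow> y = p)) \<or> (\<forall>y\<in>W. \<not> adj w y)"
  using assms(4-7)
proof (induction "card W" arbitrary: W q rule: less_induct)
  case less
  obtain w p where w: "w \<in> W" "\<forall>y\<in>W. adj w y \<longrightarrow> y = p"
    using assms(1) less.prems unfolding locally_sparse_def by meson
  consider "w \<noteq> q" | "\<forall>y\<in>W. \<not> adj w y" | "w = q" "p \<in> W" "adj w p" using w by metis
  then show ?case
  proof cases
    case 3
    have lt: "card (W - {w}) < card W" using w less.prems by (meson card_Diff1_less)
    have "p \<noteq> w" using 3 irr by metis
    then have "W - {w} \<subseteq> A" "W - {w} \<noteq> {}" "finite (W - {w})" "card (W - {w}) < g"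
      using 3 less.prems lt by auto
    from less.hyps[OF lt this, of p] obtain w' where w': "w' \<in> W - {w}"
      "(w' \<noteq> p \<and> (\<exists>p'. \<forall>y\<in>W - {w}. adj w' y \<longrightarrow> y = p')) \<or> (\<forall>y\<in>W - {w}. \<not> adj w' y)" by blast
    have "w' \<in> W" "w' \<noteq> q" using w' 3 by auto
    moreover have "\<exists>p'. \<forall>y\<in>W. adj w' y \<longrightarrow> y = p'"
    proof (cases "w' = p")
      case True
      then have "\<forall>y\<in>W - {w}. \<not> adj w' y" using w'(2) by blast
      then have "\<forall>y\<in>W. adj w' y \<longrightarrow> y = w" by blast
      then show ?thesis by blast
    next
      case False
      then have "\<not> adj w' w" using w(2) \<open>w' \<in> W\<close> sym by blast
      then show ?thesis using w'(2) by (metis Diff_iff singletonD)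
    qed
    ultimately show ?thesis by blast
  qed (use w in blast)+
qed

text \<open>\<open>Inl p\<close> is a hypergraph vertex, later a tall box; \<open>Inr (e, x)\<close>
  is the vertex \<open>x\<close> of the copy over \<open>e\<close>, matched with the point
  \<open>\<theta> e x\<close> of \<open>e\<close>.\<close>

fun attach_adj :: "('a \<Rightarrow> 'a \<Rightarrow> bool) \<Rightarrow> (nat set \<Rightarrow> 'a \<Rightarrow> nat) \<Rightarrow>
    nat + nat set \<times> 'a \<Rightarrow> nat + nat set \<times> 'a \<Rightarrow> bool" where
  "attach_adj adj \<theta> (Inl p) (Inl q) \<longleftrightarrow> False"
| "attach_adj adj \<theta> (Inl p) (Inr (e, x)) \<longleftrightarrow> \<theta> e x = p"
| "attach_adj adj \<theta> (Inr (e, x)) (Inl p) \<longleftrightarrow> \<theta> e x = p"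
| "attach_adj adj \<theta> (Inr (e, x)) (Inr (e', y)) \<longleftrightarrow> e = e' \<and> adj x y"

definition attach_verts :: "nat set set \<Rightarrow> 'a set \<Rightarrow> (nat + nat set \<times> 'a) set" where
  "attach_verts E V = Inl ` \<Union>E \<union> Inr ` (E \<times> V)"

lemma attach_vertsE:
  assumes "a \<in> attach_verts E V"
  obtains p where "p \<in> \<Union>E" "a = Inl p" | e x where "e \<in> E" "x \<in> V" "a = Inr (e, x)"
  using assms unfolding attach_verts_def by auto

text \<open>Among the hyperedges whose copies meet \<open>W\<close>, a leaf \<open>e\<close> shares
  only one point \<open>y\<close> with the others. Its copy has a vertex \<open>w\<close> of degree
  at most one that is either isolated or not matched with \<open>y\<close>. Either \<open>w\<close>
  is a leaf of \<open>W\<close>, or its matched point lies in \<open>W\<close> and in no other of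
  these hyperedges, and is a leaf.\<close>

lemma locally_sparse_attach:
  assumes E: "sparse g E" "finite E" and \<theta>: "\<And>e. e \<in> E \<Longrightarrow> bij_betw (\<theta> e) V e"
    and V: "locally_sparse g V adj"
    and sym: "\<And>x y. adj x y \<Longrightarrow> adj y x" and irr: "\<And>x. \<not> adj x x"
  shows "locally_sparse g (attach_verts E V) (attach_adj adj \<theta>)"
  unfolding locally_sparse_def
proof (intro allI impI)
  fix W assume W: "W \<subseteq> attach_verts E V" "W \<noteq> {}" "finite W" "card W < g"
  let ?G = "attach_adj adj \<theta>"
  define K where "K = {e. \<exists>x. Inr (e, x) \<in> W}"
  have Winr: "e \<in> E \<and> x \<in> V" if "Inr (e, x) \<in> W" for e x
    using that W(1) unfolding attach_verts_def by auto
  show "\<exists>w\<in>W. \<exists>p. \<forall>y\<in>W. ?G w y \<longrightarrow> y = p"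
  proof (cases "K = {}")
    case True
    obtain w where w: "w \<in> W" using W(2) by blast
    have nr: "Inr ex \<notin> W" for ex using True unfolding K_def by (cases ex) auto
    have "\<not> ?G w y" if "y \<in> W" for y
      using w that nr by (cases w; cases y) auto
    then show ?thesis using w by blast
  next
    case False
    have KE: "K \<subseteq> E" using Winr unfolding K_def by auto
    have finK: "finite K" using KE E(2) finite_subset by blast
    have "K \<subseteq> (\<lambda>w. fst (projr w)) ` W" unfolding K_def by force
    then have "card K \<le> card W" using W(3) by (meson surj_card_le)
    then have "card K \<le> g" using W(4) by simp
    then obtain e y where e: "e \<in> K" "e \<inter> \<Union>(K - {e}) \<subseteq> {y}"
      using E(1) KE False finK unfolding sparse_def by meson
    have eE: "e \<in> E" using e KE by blast
    define We where "We = {x. Inr (e, x) \<in> W}"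
    have We: "We \<subseteq> V" "We \<noteq> {}" using Winr e(1) unfolding We_def K_def by auto
    have imW: "(\<lambda>x. Inr (e, x)) ` We \<subseteq> W" unfolding We_def by auto
    have injW: "inj_on (\<lambda>x. Inr (e, x)) We" by (auto simp: inj_on_def)
    have "finite We" using finite_imageD[OF finite_subset[OF imW W(3)] injW] .
    moreover have "card We < g"
      using card_inj_on_le[OF injW imW W(3)] W(4) by simp
    ultimately obtain w where w: "w \<in> We"
      "(w \<noteq> inv_into V (\<theta> e) y \<and> (\<exists>p. \<forall>y\<in>We. adj w y \<longrightarrow> y = p)) \<or> (\<forall>y\<in>We. \<not> adj w y)"
      using locally_sparse_rooted[OF V sym irr We] by metis
    have wW: "Inr (e, w) \<in> W" "w \<in> V" using w We unfolding We_def by auto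
    show ?thesis
    proof (cases "Inl (\<theta> e w) \<in> W \<and> (\<exists>z\<in>We. adj w z)")
      case False
      then consider "Inl (\<theta> e w) \<notin> W" | "\<forall>z\<in>We. \<not> adj w z" by blast
      then have "\<exists>p. \<forall>v\<in>W. ?G (Inr (e, w)) v \<longrightarrow> v = p"
      proof cases
        case 1
        obtain p where p: "\<forall>y\<in>We. adj w y \<longrightarrow> y = p" using w(2) by blast
        have "v = Inr (e, p)" if v: "v \<in> W" "?G (Inr (e, w)) v" for v
        proof (cases v)
          case (Inl q)
          then show ?thesis using v 1 by auto
        next
          case (Inr ez)
          then obtain z where z: "v = Inr (e, z)" "adj w z" using v by (cases ez) auto
          then have "z = p" using v(1) p unfolding We_def by simp
          then show ?thesis using z by simp
        qed
        then show ?thesis by blast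
      next
        case 2
        have "v = Inl (\<theta> e w)" if v: "v \<in> W" "?G (Inr (e, w)) v" for v
        proof (cases v)
          case (Inl q)
          then show ?thesis using v by auto
        next
          case (Inr ez)
          then obtain z where z: "v = Inr (e, z)" "adj w z" using v by (cases ez) auto
          then have "z \<in> We" using v(1) unfolding We_def by simp
          then show ?thesis using z 2 by blast
        qed
        then show ?thesis by blast
      qed
      then show ?thesis using wW by blast
    next
      case True
      then have wq: "w \<noteq> inv_into V (\<theta> e) y" using w(2) by blast
      have neq: "\<theta> e w \<noteq> y" using bij_betw_inv_into_left[OF \<theta>[OF eE] wW(2)] wq by auto
      have we: "\<theta> e w \<in> e" using \<theta>[OF eE] wW(2) by (auto simp: bij_betw_def)
      have "v = Inr (e, w)" if v: "v \<in> W" "?G (Inl (\<theta> e w)) v" for v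
      proof -
        obtain e' x where v': "v = Inr (e', x)" "\<theta> e' x = \<theta> e w"
          using v(2) by (cases v) auto
        have ex: "e' \<in> E" "x \<in> V" using Winr v(1) v' by auto
        have "\<theta> e w \<in> e'" using \<theta>[OF ex(1)] ex(2) v'(2) unfolding bij_betw_def by (metis imageI)
        moreover have "e' \<in> K" using v v' unfolding K_def by blast
        ultimately have "e' = e" using e(2) we neq by blast
        then have "x = w" using \<theta>[OF eE] v'(2) ex(2) wW(2) by (simp add: bij_betw_def inj_on_def)
        then show ?thesis using v' \<open>e' = e\<close> by simp
      qed
      then show ?thesis using True by blast
    qed
  qed
qed

definition uncolorable :: "nat \<Rightarrow> 'a set \<Rightarrow> ('a \<Rightarrow> 'a \<Rightarrow> bool) \<Rightarrow> bool" where
  "uncolorable k A adj \<longleftrightarrow>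
     (\<forall>c :: 'a \<Rightarrow> nat. (\<forall>x\<in>A. c x < k) \<longrightarrow> (\<exists>x\<in>A. \<exists>y\<in>A. adj x y \<and> c x = c y))"

text \<open>The colour \<open>a\<close> of a monochromatic hyperedge is forbidden on the copy over
  it, which leaves only \<open>k\<close> colours there.\<close>

lemma uncolorable_attach:
  assumes E: "ramsey (Suc k) E" and \<theta>: "\<And>e. e \<in> E \<Longrightarrow> bij_betw (\<theta> e) V e"
    and V: "uncolorable k V adj"
  shows "uncolorable (Suc k) (attach_verts E V) (attach_adj adj \<theta>)"
  unfolding uncolorable_def
proof (intro allI impI)
  let ?A = "attach_verts E V" and ?G = "attach_adj adj \<theta>"
  fix c assume c: "\<forall>x\<in>?A. c x < Suc k"
  define c0 where "c0 p = (if p \<in> \<Union>E then c (Inl p) else 0)" for p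
  have "c0 p < Suc k" for p using c unfolding c0_def attach_verts_def by auto
  then have "\<exists>e\<in>E. \<exists>a. \<forall>p\<in>e. c0 p = a"
    by (rule E[unfolded ramsey_def, rule_format])
  then obtain e a where e: "e \<in> E" "\<forall>p\<in>e. c0 p = a" by blast
  have ea: "c (Inl p) = a" if "p \<in> e" for p
    using e that unfolding c0_def by (metis UnionI)
  have inA: "Inr (e, x) \<in> ?A" "Inl (\<theta> e x) \<in> ?A" "\<theta> e x \<in> e" if "x \<in> V" for x
    using e(1) that \<theta>[OF e(1)] unfolding attach_verts_def bij_betw_def by auto
  show "\<exists>x\<in>?A. \<exists>y\<in>?A. ?G x y \<and> c x = c y"
  proof (cases "\<exists>x\<in>V. c (Inr (e, x)) = a")
    case True
    then obtain x where x: "x \<in> V" "c (Inr (e, x)) = a" by blast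
    have "?G (Inr (e, x)) (Inl (\<theta> e x)) \<and> c (Inr (e, x)) = c (Inl (\<theta> e x))"
      using x ea inA by simp
    then show ?thesis using inA[OF x(1)] by blast
  next
    case False
    \<comment> \<open>As \<open>a\<close> is absent from the copy, it can replace the colour
      \<open>k\<close> without merging two classes.\<close>
    define c' where "c' x = (if c (Inr (e, x)) = k then a else c (Inr (e, x)))" for x
    have "c' x < k" if "x \<in> V" for x
    proof -
      have lt: "c (Inr (e, x)) < Suc k" "c (Inl (\<theta> e x)) < Suc k" using c inA[OF that] by auto
      have "a < Suc k" using lt(2) ea inA(3)[OF that] by simp
      then show ?thesis using lt(1) False that unfolding c'_def by (auto simp: less_Suc_eq)
    qed
    then obtain x y where xy: "x \<in> V" "y \<in> V" "adj x y" "c' x = c' y"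
      using V unfolding uncolorable_def by blast
    have "c (Inr (e, x)) = c (Inr (e, y))"
      using xy(4) False xy(1,2) unfolding c'_def by (metis (full_types))
    then have "?G (Inr (e, x)) (Inr (e, y)) \<and> c (Inr (e, x)) = c (Inr (e, y))" using xy by simp
    then show ?thesis using inA(1)[OF xy(1)] inA(1)[OF xy(2)] by blast
  qed
qed

section \<open>Approximately homothetic copies\<close>

lemma finite_uniform_lower:
  fixes f :: "'a \<Rightarrow> real"
  assumes "finite S" "\<And>x. x \<in> S \<Longrightarrow> 0 < f x"
  shows "\<exists>d>0. \<forall>x\<in>S. d < f x"
  using assms
proof (induction S rule: finite_induct)
  case empty
  then show ?case by (intro exI[of _ 1]) simp
next
  case (insert a S)
  then obtain d where d: "d > 0" "\<forall>x\<in>S. d < f x" by auto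
  have "f a > 0" using insert.prems by simp
  then show ?case using d by (intro exI[of _ "min d (f a / 2)"]) (auto simp: min_less_iff_disj)
qed

lemma finite_uniform_upper:
  fixes f :: "'a \<Rightarrow> real"
  assumes "finite S"
  shows "\<exists>B>0. \<forall>x\<in>S. f x < B"
proof (intro exI conjI ballI)
  let ?B = "1 + (\<Sum>x\<in>S. \<bar>f x\<bar>)"
  show "0 < ?B" by (smt (verit) sum_nonneg abs_ge_zero)
  show "f x < ?B" if "x \<in> S" for x
    using member_le_sum[OF that, of "\<lambda>x. \<bar>f x\<bar>"] assms by auto
qed

text \<open>An open interval is infinite, so finitely many values can be avoided. This separates
  hypergraph vertices over the same real point, and copies of vertices from the tall box they are
  attached to.\<close>

lemma injective_perturbation:
  fixes b :: "'a \<Rightarrow> real"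
  assumes "finite A" "finite Z" "\<rho> > 0"
  shows "\<exists>b'. inj_on b' A \<and> b' ` A \<inter> Z = {} \<and> (\<forall>a\<in>A. \<bar>b' a - b a\<bar> < \<rho>)"
  using assms(1)
proof (induction A rule: finite_induct)
  case empty
  then show ?case by simp
next
  case (insert a A)
  then obtain b' where b': "inj_on b' A" "b' ` A \<inter> Z = {}" "\<forall>a\<in>A. \<bar>b' a - b a\<bar> < \<rho>" by blast
  have "infinite {b a - \<rho><..<b a + \<rho>}" using assms(3) by (simp add: infinite_Ioo)
  moreover have "finite (b' ` A \<union> Z)" using insert.hyps assms(2) by simp
  ultimately obtain r where r: "r \<in> {b a - \<rho><..<b a + \<rho>}" "r \<notin> b' ` A \<union> Z"
    by (meson finite_subset subsetI)
  let ?b = "b'(a := r)"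
  have "?b ` A = b' ` A" using insert.hyps by auto
  moreover have "inj_on ?b A" using b'(1) insert.hyps by (auto simp: inj_on_def)
  ultimately have "inj_on ?b (insert a A)" "?b ` insert a A \<inter> Z = {}"
    using r(2) b'(2) insert.hyps by auto
  moreover have "\<forall>x\<in>insert a A. \<bar>?b x - b x\<bar> < \<rho>" using b'(3) r(1) by auto
  ultimately show ?case by blast
qed

text \<open>If every point of a copy of \<open>V\<close> blown up into a tiny cluster sees the colour \<open>a\<close>,
  these points form the required copy; otherwise some cluster avoids \<open>a\<close>.\<close>
lemma approximate_homothets:
  fixes V :: "real set" and C :: "nat set"
  assumes "finite V" "\<eta> > 0" "finite C"
  shows "\<exists>L. finite L \<and> (\<forall>c. c ` L \<subseteq> C \<longrightarrow>
     (\<exists>\<phi> r. r > 0 \<and> \<phi> ` V \<subseteq> L \<and> (\<forall>x\<in>V. \<forall>y\<in>V. \<bar>(\<phi> x - \<phi> y) - r * (x - y)\<bar> \<le> r * \<eta>) \<and>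
       (\<exists>a. \<forall>x\<in>V. c (\<phi> x) = a)))"
  using assms(3)
proof (induction C rule: finite_induct)
  case empty
  then show ?case by (intro exI[of _ "{0}"]) auto
next
  case (insert a C)
  then obtain L0 where L0: "finite L0" and IH: "\<And>c. c ` L0 \<subseteq> C \<Longrightarrow>
     (\<exists>\<phi> r. r > 0 \<and> \<phi> ` V \<subseteq> L0 \<and> (\<forall>x\<in>V. \<forall>y\<in>V. \<bar>(\<phi> x - \<phi> y) - r * (x - y)\<bar> \<le> r * \<eta>) \<and>
       (\<exists>a. \<forall>x\<in>V. c (\<phi> x) = a))" by blast
  obtain M where M: "M > 0" "\<forall>y\<in>L0. \<bar>y\<bar> < M" using finite_uniform_upper[OF L0, of abs] by blast
  \<comment> \<open>With this scale, two points of one cluster differ by at most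
    \<open>\<eta>\<close>, so picking one point per cluster gives a copy of ratio 1.\<close>
  define d where "d = \<eta> / (2 * M)"
  have d: "d > 0" "d * (2 * M) = \<eta>" using M assms(2) unfolding d_def by auto
  let ?L = "(\<lambda>(x, y). x + d * y) ` (V \<times> L0)"
  show ?case
  proof (intro exI[of _ ?L] conjI allI impI)
    show "finite ?L" using assms(1) L0 by simp
    fix c assume c: "c ` ?L \<subseteq> insert a C"
    show "\<exists>\<phi> r. r > 0 \<and> \<phi> ` V \<subseteq> ?L \<and> (\<forall>x\<in>V. \<forall>y\<in>V. \<bar>(\<phi> x - \<phi> y) - r * (x - y)\<bar> \<le> r * \<eta>) \<and>
       (\<exists>a. \<forall>x\<in>V. c (\<phi> x) = a)"
    proof (cases "\<forall>x\<in>V. \<exists>y\<in>L0. c (x + d * y) = a")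
      case True
      then obtain \<sigma> where \<sigma>: "\<And>x. x \<in> V \<Longrightarrow> \<sigma> x \<in> L0 \<and> c (x + d * \<sigma> x) = a" by metis
      have "\<bar>((x + d * \<sigma> x) - (y + d * \<sigma> y)) - 1 * (x - y)\<bar> \<le> 1 * \<eta>" if "x \<in> V" "y \<in> V" for x y
      proof -
        have "\<bar>\<sigma> x - \<sigma> y\<bar> \<le> 2 * M" using M(2) \<sigma>[OF that(1)] \<sigma>[OF that(2)] by (smt (verit))
        then have "d * \<bar>\<sigma> x - \<sigma> y\<bar> \<le> \<eta>" using d by (metis mult_left_mono less_imp_le)
        then have "\<bar>d * (\<sigma> x - \<sigma> y)\<bar> \<le> \<eta>" using d(1) by (simp add: abs_mult)
        then show ?thesis by (simp add: algebra_simps)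
      qed
      moreover have "(\<lambda>x. x + d * \<sigma> x) ` V \<subseteq> ?L" using \<sigma> by force
      ultimately show ?thesis using \<sigma>
        by (intro exI[of _ "\<lambda>x. x + d * \<sigma> x"] exI[of _ 1]) auto
    next
      case False
      then obtain x0 where x0: "x0 \<in> V" "\<forall>y\<in>L0. c (x0 + d * y) \<noteq> a" by blast
      \<comment> \<open>The cluster at \<open>x0\<close> is an exact homothet of \<open>L0\<close>.
        The error bound is relative to \<open>r\<close>, so rescaling by \<open>d\<close> preserves
        it.\<close>
      have "(\<lambda>y. c (x0 + d * y)) ` L0 \<subseteq> C"
      proof
        fix b assume "b \<in> (\<lambda>y. c (x0 + d * y)) ` L0"
        then obtain y where y: "y \<in> L0" "b = c (x0 + d * y)" by blast
        have "x0 + d * y \<in> ?L" using x0(1) y(1) by force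
        then show "b \<in> C" using c x0(2) y by blast
      qed
      from IH[OF this] obtain \<phi> r b where \<phi>: "r > 0" "\<phi> ` V \<subseteq> L0"
        "\<forall>x\<in>V. \<forall>y\<in>V. \<bar>(\<phi> x - \<phi> y) - r * (x - y)\<bar> \<le> r * \<eta>" "\<forall>x\<in>V. c (x0 + d * \<phi> x) = b" by blast
      have "\<bar>((x0 + d * \<phi> x) - (x0 + d * \<phi> y)) - (d * r) * (x - y)\<bar> \<le> (d * r) * \<eta>"
        if "x \<in> V" "y \<in> V" for x y
      proof -
        have "((x0 + d * \<phi> x) - (x0 + d * \<phi> y)) - (d * r) * (x - y) = d * ((\<phi> x - \<phi> y) - r * (x - y))"
          by (simp add: algebra_simps)
        then show ?thesis using \<phi>(3) that d(1) by (simp add: abs_mult mult.assoc)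
      qed
      moreover have "(\<lambda>x. x0 + d * \<phi> x) ` V \<subseteq> ?L" using \<phi>(2) x0(1) by force
      ultimately show ?thesis using \<phi>(1,4) d(1)
        by (intro exI[of _ "\<lambda>x. x0 + d * \<phi> x"] exI[of _ "d * r"]) auto
    qed
  qed
qed

section \<open>Geometric representations\<close>

text \<open>A grounded square box has the form \<open>[t, t + s] \<times> [t - s, t] \<times> [l, u]\<close>; two such boxes meet
  iff \<open>\<bar>t - t'\<bar> \<le> min s s'\<close> and their vertical intervals meet.\<close>

definition touch :: "('a \<Rightarrow> real) \<Rightarrow> ('a \<Rightarrow> real) \<Rightarrow> ('a \<Rightarrow> real) \<Rightarrow> ('a \<Rightarrow> real) \<Rightarrow> 'a \<Rightarrow> 'a \<Rightarrow> bool" where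
  "touch t s l u x y \<longleftrightarrow> x \<noteq> y \<and> \<bar>t x - t y\<bar> \<le> min (s x) (s y) \<and> l x \<le> u y \<and> l y \<le> u x"

text \<open>The strict inequality makes the adjacencies stable under small changes of \<open>t\<close>.\<close>
definition box_system :: "nat \<Rightarrow> nat \<Rightarrow> 'a set \<Rightarrow>
    ('a \<Rightarrow> real) \<Rightarrow> ('a \<Rightarrow> real) \<Rightarrow> ('a \<Rightarrow> real) \<Rightarrow> ('a \<Rightarrow> real) \<Rightarrow> bool" where
  "box_system g k A t s l u \<longleftrightarrow>
     finite A \<and> inj_on t A \<and> (\<forall>x\<in>A. 0 < s x \<and> l x \<le> u x) \<and>
     (\<forall>x\<in>A. \<forall>y\<in>A. touch t s l u x y \<longrightarrow> \<bar>t x - t y\<bar> < min (s x) (s y)) \<and>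
     locally_sparse g A (touch t s l u) \<and> uncolorable k A (touch t s l u)"

lemma touch_sym: "touch t s l u x y \<Longrightarrow> touch t s l u y x"
  unfolding touch_def by (auto simp: abs_minus_commute)

lemma touch_irrefl: "\<not> touch t s l u x x"
  unfolding touch_def by simp

lemma locally_sparse_cong:
  assumes "locally_sparse g A adj" "\<And>x y. x \<in> A \<Longrightarrow> y \<in> A \<Longrightarrow> adj' x y \<Longrightarrow> adj x y"
  shows "locally_sparse g A adj'"
  unfolding locally_sparse_def
proof (intro allI impI)
  fix W assume W: "W \<subseteq> A" "W \<noteq> {}" "finite W" "card W < g"
  then obtain w p where w: "w \<in> W" "\<forall>y\<in>W. adj w y \<longrightarrow> y = p"
    using assms(1) unfolding locally_sparse_def by meson
  then have "\<forall>y\<in>W. adj' w y \<longrightarrow> y = p" using assms(2) W(1) by (meson subsetD)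
  then show "\<exists>w\<in>W. \<exists>p. \<forall>y\<in>W. adj' w y \<longrightarrow> y = p" using w(1) by blast
qed

lemma uncolorable_cong:
  assumes "uncolorable k A adj" "\<And>x y. x \<in> A \<Longrightarrow> y \<in> A \<Longrightarrow> adj x y \<Longrightarrow> adj' x y"
  shows "uncolorable k A adj'"
  unfolding uncolorable_def
proof (intro allI impI)
  fix c assume "\<forall>x\<in>A. c x < k"
  with assms(1) obtain x y where "x \<in> A" "y \<in> A" "adj x y \<and> c x = c y"
    unfolding uncolorable_def by (elim allE impE bexE)
  then show "\<exists>x\<in>A. \<exists>y\<in>A. adj' x y \<and> c x = c y"
    using assms(2) by (intro bexI[of _ x] bexI[of _ y]) auto
qed

text \<open>The induction on \<open>k\<close> needs a fixed type, and the copying step needs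
  vertices that are real positions. Since \<open>t\<close> is injective, positions can serve as
  names.\<close>

lemma box_system_reindex:
  assumes "box_system g k A t s l u"
  shows "\<exists>(V :: real set) s l u. box_system g k V (\<lambda>x. x) s l u"
proof -
  let ?i = "inv_into A t"
  have A: "finite A" "inj_on t A" "\<forall>x\<in>A. 0 < s x \<and> l x \<le> u x"
    "\<forall>x\<in>A. \<forall>y\<in>A. touch t s l u x y \<longrightarrow> \<bar>t x - t y\<bar> < min (s x) (s y)"
    "locally_sparse g A (touch t s l u)" "uncolorable k A (touch t s l u)"
    using assms unfolding box_system_def by auto
  have inv: "?i (t x) = x" if "x \<in> A" for x using A(2) that by simp
  let ?T = "touch (\<lambda>x. x) (s \<circ> ?i) (l \<circ> ?i) (u \<circ> ?i)"
  have T: "?T (t x) (t y) \<longleftrightarrow> touch t s l u x y" if "x \<in> A" "y \<in> A" for x y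
    using that A(2) unfolding touch_def by (auto simp: inv inj_on_def)
  have "locally_sparse g (t ` A) ?T"
    unfolding locally_sparse_def
  proof (intro allI impI)
    fix W assume W: "W \<subseteq> t ` A" "W \<noteq> {}" "finite W" "card W < g"
    have sub: "?i ` W \<subseteq> A" using W(1) inv by auto
    have "card (?i ` W) < g" using W(3,4) card_image_le[of W ?i] by linarith
    then obtain w p where w: "w \<in> ?i ` W" "\<forall>y\<in>?i ` W. touch t s l u w y \<longrightarrow> y = p"
      using A(5) W(2,3) sub unfolding locally_sparse_def by (metis finite_imageI image_is_empty)
    have tW: "t (?i y) = y" if "y \<in> W" for y using W(1) that by (meson f_inv_into_f subsetD)
    have "t w \<in> W" using w(1) tW by auto
    moreover have "y = t p" if y: "y \<in> W" "?T (t w) y" for y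
    proof -
      have "touch t s l u w (?i y)" using T[of w "?i y"] tW[OF y(1)] y sub w(1) by auto
      then have "?i y = p" using w(2) y(1) by blast
      then show ?thesis using tW[OF y(1)] by simp
    qed
    ultimately show "\<exists>w\<in>W. \<exists>p. \<forall>y\<in>W. ?T w y \<longrightarrow> y = p" by blast
  qed
  moreover have "uncolorable k (t ` A) ?T"
    unfolding uncolorable_def
  proof (intro allI impI)
    fix c :: "real \<Rightarrow> nat" assume "\<forall>x\<in>t ` A. c x < k"
    then have "\<forall>x\<in>A. (c \<circ> t) x < k" by simp
    then obtain x y where "x \<in> A" "y \<in> A" "touch t s l u x y" "(c \<circ> t) x = (c \<circ> t) y"
      using A(6) unfolding uncolorable_def by blast
    then have "t x \<in> t ` A" "t y \<in> t ` A" "?T (t x) (t y) \<and> c (t x) = c (t y)" using T by auto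
    then show "\<exists>x\<in>t ` A. \<exists>y\<in>t ` A. ?T x y \<and> c x = c y" by blast
  qed
  moreover have "\<forall>x\<in>t ` A. \<forall>y\<in>t ` A. ?T x y \<longrightarrow> \<bar>x - y\<bar> < min ((s \<circ> ?i) x) ((s \<circ> ?i) y)"
    using A(4) T by (simp add: inv)
  ultimately have "box_system g k (t ` A) (\<lambda>x. x) (s \<circ> ?i) (l \<circ> ?i) (u \<circ> ?i)"
    unfolding box_system_def using A(1,3) by (simp add: inv)
  then show ?thesis by blast
qed

text \<open>The tolerances form a chain: \<open>\<eta>\<close> depends on the old system alone,
  \<open>\<rho>1\<close> on the ratios \<open>r e\<close> of the hyperedges, and
  \<open>\<rho>2\<close> also on the perturbed positions \<open>Q\<close>.\<close>

lemma box_system_step: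
  fixes V :: "real set"
  assumes "box_system g k V (\<lambda>x. x) s l u"
  shows "\<exists>(A :: (nat + nat set \<times> real) set) t s l u. box_system g (Suc k) A t s l u"
proof -
  let ?adj = "touch (\<lambda>x. x) s l u"
  have V: "finite V" "\<forall>x\<in>V. 0 < s x \<and> l x \<le> u x"
    "\<forall>x\<in>V. \<forall>y\<in>V. ?adj x y \<longrightarrow> \<bar>x - y\<bar> < min (s x) (s y)"
    "locally_sparse g V ?adj" "uncolorable k V ?adj"
    using assms unfolding box_system_def by auto
  define slack where "slack = (\<lambda>(x, y). \<bar>\<bar>x - y\<bar> - min (s x) (s y)\<bar>)"
  let ?P = "{(x, y) \<in> V \<times> V. x \<noteq> y \<and> l x \<le> u y \<and> l y \<le> u x}"
  have finVV: "finite (V \<times> V)" using V(1) by simp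
  \<comment> \<open>Only pairs that overlap vertically matter, the others being apart wherever they
    stand. Strictness in \<open>box_system\<close> excludes equality for touching pairs.\<close>
  have "0 < slack p" if "p \<in> ?P" for p
  proof -
    obtain x y where p: "p = (x, y)" by fastforce
    have xy: "x \<in> V" "y \<in> V" "x \<noteq> y" "l x \<le> u y" "l y \<le> u x" using that p by auto
    have "\<bar>x - y\<bar> \<noteq> min (s x) (s y)"
    proof
      assume eq: "\<bar>x - y\<bar> = min (s x) (s y)"
      then have "?adj x y" using xy unfolding touch_def by (simp del: min.bounded_iff)
      then have "\<bar>x - y\<bar> < min (s x) (s y)" using V(3) xy by blast
      then show False using eq by linarith
    qed
    then show ?thesis unfolding p slack_def by simp
  qed
  moreover have "finite ?P" by (rule finite_subset[OF _ finVV]) auto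
  ultimately obtain d1 where d1: "d1 > 0" "\<forall>p\<in>?P. d1 < slack p"
    using finite_uniform_lower[of ?P slack] by blast
  let ?D = "{(x, y) \<in> V \<times> V. x \<noteq> y}"
  have "finite ?D" by (rule finite_subset[OF _ finVV]) auto
  then obtain d2 where d2: "d2 > 0" "\<forall>p\<in>?D. d2 < (\<lambda>(x, y). \<bar>x - y\<bar>) p"
    using finite_uniform_lower[of ?D "\<lambda>(x, y). \<bar>x - y\<bar>"] by auto
  \<comment> \<open>The third of \<open>d1\<close> leaves room for one homothety error and two
    displaced endpoints, each at most \<open>r * \<eta>\<close>; \<open>d2\<close> makes approximate
    homothets injective.\<close>
  define \<eta> where "\<eta> = min (d1 / 3) d2"
  have \<eta>: "\<eta> > 0" "3 * \<eta> \<le> d1" "\<eta> \<le> d2" using d1(1) d2(1) unfolding \<eta>_def by auto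

  \<comment> \<open>The sparse hypergraph of approximate homothets\<close>
  define homothet :: "(real \<Rightarrow> real) \<Rightarrow> real \<Rightarrow> bool" where
    "homothet \<phi> r \<longleftrightarrow> r > 0 \<and> (\<forall>x\<in>V. \<forall>y\<in>V. \<bar>(\<phi> x - \<phi> y) - r * (x - y)\<bar> \<le> r * \<eta>)" for \<phi> r
  obtain L where finL: "finite L" and L0: "\<forall>c. c ` L \<subseteq> {..<Suc k} \<longrightarrow>
      (\<exists>\<phi> r. r > 0 \<and> \<phi> ` V \<subseteq> L \<and> (\<forall>x\<in>V. \<forall>y\<in>V. \<bar>(\<phi> x - \<phi> y) - r * (x - y)\<bar> \<le> r * \<eta>) \<and>
        (\<exists>a. \<forall>x\<in>V. c (\<phi> x) = a))"
    using approximate_homothets[OF V(1) \<eta>(1) finite_lessThan[of "Suc k"]] by (elim exE conjE)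
  have L: "\<exists>\<phi> r. homothet \<phi> r \<and> \<phi> ` V \<subseteq> L \<and> (\<exists>a. \<forall>x\<in>V. c (\<phi> x) = a)"
    if "c ` L \<subseteq> {..<Suc k}" for c
    using L0[rule_format, OF that] unfolding homothet_def by (elim exE conjE) (intro exI conjI; assumption)
  define F where "F = {f. \<exists>\<phi> r. homothet \<phi> r \<and> \<phi> ` V \<subseteq> L \<and> f = \<phi> ` V}"
  have FL: "F \<subseteq> Pow L" unfolding F_def by auto
  have finF: "finite F" using finite_subset[OF FL] finL by simp
  have finF': "\<forall>f\<in>F. finite f" using FL finL by (meson PowD finite_subset subsetD)
  have ramF: "ramsey (Suc k) F"
    unfolding ramsey_def
  proof (intro allI impI)
    fix c :: "real \<Rightarrow> nat" assume "\<forall>v. c v < Suc k"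
    then have "c ` L \<subseteq> {..<Suc k}" by auto
    from L[OF this] obtain \<phi> r a where \<phi>: "homothet \<phi> r" "\<phi> ` V \<subseteq> L" "\<forall>x\<in>V. c (\<phi> x) = a" by blast
    then have "\<phi> ` V \<in> F" unfolding F_def by blast
    then show "\<exists>f\<in>F. \<exists>a. \<forall>v\<in>f. c v = a" using \<phi>(3) by (intro bexI[of _ "\<phi> ` V"] exI[of _ a]) auto
  qed
  obtain E \<pi> where part: "partite F E \<pi>" and spE: "sparse (Suc g) E" and ramE: "ramsey (Suc k) E"
    using sparse_ramsey[OF finF finF' ramF] by blast
  have finE: "finite E" and Ee: "\<And>e. e \<in> E \<Longrightarrow> finite e \<and> inj_on \<pi> e \<and> \<pi> ` e \<in> F"
    using part unfolding partite_def by auto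
  have spE': "sparse g E" using spE unfolding sparse_def by auto
  have "\<exists>\<phi> r. homothet \<phi> r \<and> \<pi> ` e = \<phi> ` V" if "e \<in> E" for e
  proof -
    have "\<pi> ` e \<in> F" using Ee[OF that] by simp
    then show ?thesis unfolding F_def by (elim CollectE exE conjE) (intro exI conjI)
  qed
  then obtain \<phi> r where \<phi>: "\<And>e. e \<in> E \<Longrightarrow> homothet (\<phi> e) (r e) \<and> \<pi> ` e = \<phi> e ` V" by metis
  have r: "r e > 0" if "e \<in> E" for e using \<phi>[OF that] unfolding homothet_def by simp
  have \<phi>inj: "inj_on (\<phi> e) V" if e: "e \<in> E" for e
  proof (rule inj_onI, rule ccontr)
    fix x y assume xy: "x \<in> V" "y \<in> V" "\<phi> e x = \<phi> e y" "x \<noteq> y"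
    have "\<bar>(\<phi> e x - \<phi> e y) - r e * (x - y)\<bar> \<le> r e * \<eta>"
      using \<phi>[OF e] xy unfolding homothet_def by blast
    then have "r e * \<bar>x - y\<bar> \<le> r e * \<eta>" using xy(3) r[OF e] by (simp add: abs_mult)
    then have "\<bar>x - y\<bar> \<le> \<eta>" using r[OF e] by simp
    moreover have "d2 < \<bar>x - y\<bar>" using d2(2) xy by auto
    ultimately show False using \<eta>(3) by simp
  qed
  define \<theta> where "\<theta> e x = inv_into e \<pi> (\<phi> e x)" for e x
  have \<theta>: "bij_betw (\<theta> e) V e" if e: "e \<in> E" for e
  proof -
    have "bij_betw (\<phi> e) V (\<pi> ` e)" using \<phi>[OF e] \<phi>inj[OF e] by (simp add: bij_betw_def)
    moreover have "bij_betw (inv_into e \<pi>) (\<pi> ` e) e"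
      using Ee[OF e] by (intro bij_betw_inv_into) (simp add: bij_betw_def)
    ultimately show ?thesis using bij_betw_trans unfolding \<theta>_def comp_def by blast
  qed
  have \<theta>e: "\<theta> e x \<in> e" if "e \<in> E" "x \<in> V" for e x using \<theta> that by (auto simp: bij_betw_def)
  have \<pi>\<theta>: "\<pi> (\<theta> e x) = \<phi> e x" if "e \<in> E" "x \<in> V" for e x
    unfolding \<theta>_def using \<phi>[OF that(1)] that(2) by (simp add: f_inv_into_f)

  \<comment> \<open>Positions, side lengths and heights of the new boxes\<close>
  have finU: "finite (\<Union>E)" using finE Ee by blast
  \<comment> \<open>A vertex of a copy is displaced twice, by \<open>Q\<close> and by
    \<open>R\<close>; each may use half of \<open>r e * \<eta>\<close>.\<close>
  have "\<exists>d>0. \<forall>e\<in>E. d < r e * \<eta> / 2"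
    by (rule finite_uniform_lower[OF finE]) (use r \<eta>(1) in simp)
  then obtain \<rho>1 where \<rho>1: "\<rho>1 > 0" "\<And>e. e \<in> E \<Longrightarrow> \<rho>1 < r e * \<eta> / 2" by blast
  obtain Q where Q: "inj_on Q (\<Union>E)" "\<And>p. p \<in> \<Union>E \<Longrightarrow> \<bar>Q p - \<pi> p\<bar> < \<rho>1"
    using injective_perturbation[OF finU, of "{}" \<rho>1 \<pi>] \<rho>1(1) by auto
  let ?U = "{(p, q) \<in> \<Union>E \<times> \<Union>E. p \<noteq> q}"
  have finUU: "finite (\<Union>E \<times> \<Union>E)" using finU by simp
  have "finite ?U" by (rule finite_subset[OF _ finUU]) auto
  moreover have "0 < (\<lambda>(p, q). \<bar>Q p - Q q\<bar>) pq" if "pq \<in> ?U" for pq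
    using that Q(1) by (auto simp: inj_on_def)
  ultimately obtain d3 where d3: "d3 > 0" "\<forall>pq\<in>?U. d3 < (\<lambda>(p, q). \<bar>Q p - Q q\<bar>) pq"
    using finite_uniform_lower[of ?U "\<lambda>(p, q). \<bar>Q p - Q q\<bar>"] by blast
  have finEV: "finite (E \<times> V)" using finE V(1) by simp
  have "\<exists>d>0. \<forall>p\<in>E \<times> V. d < r (fst p) * s (snd p)"
    by (rule finite_uniform_lower[OF finEV]) (use r V(2) in auto)
  then obtain d4 where d4: "d4 > 0" "\<And>e x. e \<in> E \<Longrightarrow> x \<in> V \<Longrightarrow> d4 < r e * s x" by fastforce
  \<comment> \<open>This is the side length of the tall boxes: at most \<open>d3 / 2\<close>, so a
    position near one tall box is far from all others, and at most \<open>d4\<close>, so it is the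
    smaller side in each contact with a copy.\<close>
  define \<rho>2 where "\<rho>2 = min \<rho>1 (min (d3 / 2) d4)"
  have \<rho>2: "\<rho>2 > 0" "\<rho>2 \<le> \<rho>1" "2 * \<rho>2 \<le> d3" "\<rho>2 \<le> d4"
    using \<rho>1(1) d3(1) d4(1) unfolding \<rho>2_def by auto
  obtain R where R: "inj_on R (E \<times> V)" "R ` (E \<times> V) \<inter> Q ` \<Union>E = {}"
    "\<And>e x. e \<in> E \<Longrightarrow> x \<in> V \<Longrightarrow> \<bar>R (e, x) - Q (\<theta> e x)\<bar> < \<rho>2"
    using injective_perturbation[OF finEV finite_imageI[OF finU, of Q] \<rho>2(1), of "\<lambda>(e, x). Q (\<theta> e x)"] by force
  obtain K where K: "K > 0" "\<forall>x\<in>V. \<bar>l x\<bar> + \<bar>u x\<bar> < K"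
    using finite_uniform_upper[OF V(1), of "\<lambda>x. \<bar>l x\<bar> + \<bar>u x\<bar>"] by blast
  \<comment> \<open>Levels differ by at least \<open>2 * K\<close>, while \<open>K\<close> bounds
    all old heights, so distinct copies cannot meet.\<close>
  define lev where "lev e = 2 * K * real (set_encode e)" for e
  have lev: "lev e + 2 * K \<le> lev e' \<or> lev e' + 2 * K \<le> lev e" if "e \<in> E" "e' \<in> E" "e \<noteq> e'" for e e'
  proof -
    have "set_encode e \<noteq> set_encode e'" using that Ee by (simp add: set_encode_eq)
    then have "real (set_encode e) + 1 \<le> real (set_encode e') \<or> real (set_encode e') + 1 \<le> real (set_encode e)"
      by linarith
    then show ?thesis using K(1) unfolding lev_def
      by (metis (no_types, opaque_lifting) distrib_left mult.right_neutral mult_left_mono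
          mult_pos_pos zero_less_numeral less_imp_le)
  qed
  obtain B where B: "B > 0" "\<forall>e\<in>E. lev e + K < B"
    using finite_uniform_upper[OF finE, of "\<lambda>e. lev e + K"] by blast
  have lev0: "lev e \<ge> 0" for e unfolding lev_def using K(1) by simp

  \<comment> \<open>Contacts of the new boxes\<close>
  define t' where "t' = case_sum Q R"
  define s' where "s' = case_sum (\<lambda>_::nat. \<rho>2) (\<lambda>(e, x). r e * s x)"
  define l' where "l' = case_sum (\<lambda>_::nat. - B - K) (\<lambda>(e, x). l x + lev e)"
  define u' where "u' = case_sum (\<lambda>_::nat. B + K) (\<lambda>(e, x). u x + lev e)"
  let ?A = "attach_verts E V" and ?T = "touch t' s' l' u'" and ?G = "attach_adj ?adj \<theta>"
  have cross: "(?T (Inl p) (Inr (e, x)) \<longleftrightarrow> \<theta> e x = p) \<and>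
      (\<theta> e x = p \<longrightarrow> \<bar>t' (Inl p) - t' (Inr (e, x))\<bar> < min (s' (Inl p)) (s' (Inr (e, x))))"
    if "p \<in> \<Union>E" "e \<in> E" "x \<in> V" for p e x
  proof -
    have sx: "\<rho>2 < r e * s x" using d4(2)[OF that(2,3)] \<rho>2(4) by simp
    have "\<bar>l x\<bar> + \<bar>u x\<bar> < K" "lev e + K < B" using K(2) B(2) that by auto
    then have z: "- B - K \<le> u x + lev e" "l x + lev e \<le> B + K" using lev0[of e] K(1) B(1) by linarith+
    have close: "\<bar>R (e, x) - Q (\<theta> e x)\<bar> < \<rho>2" using R(3) that by simp
    have far: "\<bar>Q p - R (e, x)\<bar> > \<rho>2" if "\<theta> e x \<noteq> p"
    proof -
      have "\<theta> e x \<in> \<Union>E" using \<theta>e \<open>e \<in> E\<close> \<open>x \<in> V\<close> by blast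
      then have "d3 < \<bar>Q p - Q (\<theta> e x)\<bar>" using d3(2) that \<open>p \<in> \<Union>E\<close> by auto
      then show ?thesis using close \<rho>2(3) by linarith
    qed
    show ?thesis
    proof (cases "\<theta> e x = p")
      case True
      then show ?thesis using sx close z unfolding touch_def t'_def s'_def l'_def u'_def by auto
    next
      case False
      then show ?thesis using far unfolding touch_def t'_def s'_def by auto
    qed
  qed
  have clones: "(?T (Inr (e, x)) (Inr (e', y)) \<longleftrightarrow> e = e' \<and> ?adj x y) \<and>
      (?T (Inr (e, x)) (Inr (e', y)) \<longrightarrow>
        \<bar>t' (Inr (e, x)) - t' (Inr (e', y))\<bar> < min (s' (Inr (e, x))) (s' (Inr (e', y))))"
    if ex: "e \<in> E" "x \<in> V" and ey: "e' \<in> E" "y \<in> V" for e x e' y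
  proof (cases "e = e'")
    case False
    have "\<bar>l x\<bar> + \<bar>u x\<bar> < K" "\<bar>l y\<bar> + \<bar>u y\<bar> < K" using K(2) that by auto
    then have "\<not> (l x + lev e \<le> u y + lev e' \<and> l y + lev e' \<le> u x + lev e)"
      using lev[OF ex(1) ey(1) False] by linarith
    then show ?thesis using False unfolding touch_def l'_def u'_def by auto
  next
    case e': True
    have near: "\<bar>R (e, z) - \<phi> e z\<bar> < r e * \<eta>" if "z \<in> V" for z
    proof -
      have "\<theta> e z \<in> \<Union>E" using \<theta>e ex(1) that by blast
      then have "\<bar>Q (\<theta> e z) - \<phi> e z\<bar> < \<rho>1" using Q(2) \<pi>\<theta>[OF ex(1) that] by metis
      then show ?thesis using R(3)[OF ex(1) that] \<rho>1(2)[OF ex(1)] \<rho>2(2) by linarith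
    qed
    have "\<bar>(\<phi> e x - \<phi> e y) - r e * (x - y)\<bar> \<le> r e * \<eta>"
      using \<phi>[OF ex(1)] ex ey unfolding homothet_def by blast
    then have "\<bar>(R (e, x) - R (e, y)) - r e * (x - y)\<bar> < 3 * (r e * \<eta>)"
      using near[OF ex(2)] near[OF ey(2)] by linarith
    moreover have "3 * (r e * \<eta>) \<le> r e * d1" using \<eta>(2) r[OF ex(1)]
      by (metis mult.left_commute mult_left_mono less_imp_le)
    moreover have "r e * \<bar>x - y\<bar> = \<bar>r e * (x - y)\<bar>" using r[OF ex(1)] by (simp add: abs_mult)
    ultimately have dist: "\<bar>\<bar>R (e, x) - R (e, y)\<bar> - r e * \<bar>x - y\<bar>\<bar> < r e * d1" by linarith
    have mm: "min (r e * s x) (r e * s y) = r e * min (s x) (s y)"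
      using r[OF ex(1)] by (simp add: min_mult_distrib_left)
    show ?thesis
    proof (cases "(x, y) \<in> ?P")
      case False
      then show ?thesis using ex(2) ey(2) unfolding touch_def l'_def u'_def e' by auto
    next
      case True
      then have "d1 < \<bar>\<bar>x - y\<bar> - min (s x) (s y)\<bar>" using d1(2) unfolding slack_def by auto
      then have "r e * d1 < r e * \<bar>\<bar>x - y\<bar> - min (s x) (s y)\<bar>" using r[OF ex(1)] by simp
      also have "\<dots> = \<bar>r e * \<bar>x - y\<bar> - r e * min (s x) (s y)\<bar>"
        using r[OF ex(1)] by (simp add: abs_mult flip: right_diff_distrib)
      finally have gap: "r e * d1 < \<bar>r e * \<bar>x - y\<bar> - r e * min (s x) (s y)\<bar>" .
      have cmp: "r e * \<bar>x - y\<bar> \<le> r e * min (s x) (s y) \<longleftrightarrow> \<bar>x - y\<bar> \<le> min (s x) (s y)"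
        using r[OF ex(1)] by (simp del: min.bounded_iff)
      have "0 < r e * d1" using r[OF ex(1)] d1(1) by simp
      \<comment> \<open>The new distance is off by less than \<open>r e * d1\<close>, which is below
        the scaled slack, so it stays on the same side of the threshold and never hits it.\<close>
      have "(\<bar>R (e, x) - R (e, y)\<bar> \<le> min (r e * s x) (r e * s y) \<longleftrightarrow> \<bar>x - y\<bar> \<le> min (s x) (s y)) \<and>
        (\<bar>R (e, x) - R (e, y)\<bar> \<le> min (r e * s x) (r e * s y) \<longrightarrow>
          \<bar>R (e, x) - R (e, y)\<bar> < min (r e * s x) (r e * s y))"
        unfolding mm cmp[symmetric] using dist gap by linarith
      then show ?thesis using True
        unfolding touch_def t'_def s'_def l'_def u'_def e'
        by (simp del: min.bounded_iff min_less_iff_conj)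
    qed
  qed
  have TG: "(?T a b \<longleftrightarrow> ?G a b) \<and> (?T a b \<longrightarrow> \<bar>t' a - t' b\<bar> < min (s' a) (s' b))"
    if ab: "a \<in> ?A" "b \<in> ?A" for a b
  proof -
    show ?thesis
    proof (rule attach_vertsE[OF ab(1)]; rule attach_vertsE[OF ab(2)])
      fix p q assume p: "p \<in> \<Union>E" "a = Inl p" and q: "q \<in> \<Union>E" "b = Inl q"
      have "\<not> ?T a b"
      proof
        assume T: "?T a b"
        then have "p \<noteq> q" using p q unfolding touch_def by simp
        then have "d3 < \<bar>Q p - Q q\<bar>" using d3(2) p(1) q(1) by auto
        moreover have "\<bar>Q p - Q q\<bar> \<le> \<rho>2" using T p q unfolding touch_def t'_def s'_def by simp
        ultimately show False using \<rho>2(1,3) by simp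
      qed
      then show ?thesis using p q by simp
    next
      fix p e x assume p: "p \<in> \<Union>E" "a = Inl p" and ex: "e \<in> E" "x \<in> V" "b = Inr (e, x)"
      show ?thesis using cross[OF p(1) ex(1,2)] p ex by simp
    next
      fix e x p assume ex: "e \<in> E" "x \<in> V" "a = Inr (e, x)" and p: "p \<in> \<Union>E" "b = Inl p"
      have "?T a b \<longleftrightarrow> ?T b a" using touch_sym by metis
      then show ?thesis using cross[OF p(1) ex(1,2)] unfolding p(2) ex(3)
        by (simp add: min.commute abs_minus_commute)
    next
      fix e x e' y assume ex: "e \<in> E" "x \<in> V" "a = Inr (e, x)" and ey: "e' \<in> E" "y \<in> V" "b = Inr (e', y)"
      show ?thesis using clones[OF ex(1,2) ey(1,2)] unfolding ex(3) ey(3) attach_adj.simps .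
    qed
  qed
  have "box_system g (Suc k) ?A t' s' l' u'"
    unfolding box_system_def
  proof (intro conjI)
    show "finite ?A" unfolding attach_verts_def using finU finEV by simp
    have QR: "R (e, x) \<noteq> Q p" if "e \<in> E" "x \<in> V" "p \<in> \<Union>E" for e x p
      using that R(2) by (metis IntI emptyE imageI SigmaI)
    show "inj_on t' ?A"
    proof (rule inj_onI)
      fix a b assume a: "a \<in> ?A" and b: "b \<in> ?A" and t: "t' a = t' b"
      show "a = b"
      proof (rule attach_vertsE[OF a]; rule attach_vertsE[OF b])
        fix p q assume "p \<in> \<Union>E" "a = Inl p" "q \<in> \<Union>E" "b = Inl q"
        then show ?thesis using t inj_onD[OF Q(1), of p q] unfolding t'_def by simp
      next
        fix p e x assume "p \<in> \<Union>E" "a = Inl p" "e \<in> E" "x \<in> V" "b = Inr (e, x)"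
        then show ?thesis using t QR[of e x p] unfolding t'_def by simp
      next
        fix p e x assume "e \<in> E" "x \<in> V" "a = Inr (e, x)" "p \<in> \<Union>E" "b = Inl p"
        then show ?thesis using t QR[of e x p] unfolding t'_def by simp
      next
        fix e x e' y
        assume "e \<in> E" "x \<in> V" "a = Inr (e, x)" "e' \<in> E" "y \<in> V" "b = Inr (e', y)"
        then show ?thesis using t inj_onD[OF R(1), of "(e, x)" "(e', y)"] unfolding t'_def by simp
      qed
    qed
    show "\<forall>x\<in>?A. 0 < s' x \<and> l' x \<le> u' x"
      using \<rho>2(1) r V(2) B(1) K(1) unfolding attach_verts_def s'_def l'_def u'_def by auto
    show "\<forall>x\<in>?A. \<forall>y\<in>?A. ?T x y \<longrightarrow> \<bar>t' x - t' y\<bar> < min (s' x) (s' y)" using TG by blast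
    show "locally_sparse g ?A ?T"
      by (rule locally_sparse_cong[OF locally_sparse_attach[OF spE' finE \<theta> V(4) touch_sym touch_irrefl]])
        (use TG in auto)
    show "uncolorable (Suc k) ?A ?T"
      by (rule uncolorable_cong[OF uncolorable_attach[OF ramE \<theta> V(5)]]) (use TG in auto)
  qed
  then show ?thesis by blast
qed

lemma box_system_exists: "\<exists>(V :: real set) s l u. box_system g k V (\<lambda>x. x) s l u"
proof (induction k)
  case 0
  \<comment> \<open>With no colours available, a single vertex is already uncolourable.\<close>
  have "box_system g 0 {0 :: real} (\<lambda>x. x) (\<lambda>_. 1) (\<lambda>_. 0) (\<lambda>_. 0)"
    unfolding box_system_def locally_sparse_def uncolorable_def touch_def by auto
  then show ?case by blast
next
  case (Suc k)
  then obtain V :: "real set" and s l u where "box_system g k V (\<lambda>x. x) s l u" by blast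
  then obtain A :: "(nat + nat set \<times> real) set" and t s l u where "box_system g (Suc k) A t s l u"
    using box_system_step by blast
  then show ?case by (rule box_system_reindex)
qed

section \<open>From box systems to intersection graphs\<close>

definition grounded_box :: "real \<Rightarrow> real \<Rightarrow> real \<Rightarrow> real \<Rightarrow> (real \<times> real \<times> real) set" where
  "grounded_box t s l u = {t..t + s} \<times> {t - s..t} \<times> {l..u}"

lemma grounded_square_box_grounded_box:
  assumes "0 \<le> s" "l \<le> u"
  shows "grounded_square_box (grounded_box t s l u)"
  unfolding grounded_square_box_def
proof (intro conjI)
  show "square_box (grounded_box t s l u)"
    unfolding square_box_def grounded_box_def
    by (rule exI[of _ t], rule exI[of _ "t + s"], rule exI[of _ "t - s"], rule exI[of _ t],
        rule exI[of _ l], rule exI[of _ u]) (use assms in auto)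
  have "(t, t, l) \<in> grounded_box t s l u \<inter> diagonal_plane"
    unfolding grounded_box_def diagonal_plane_def using assms by simp
  then show "grounded_box t s l u \<inter> diagonal_plane \<noteq> {}" by blast
qed (auto simp: grounded_box_def)

text \<open>For \<open>t < t'\<close> the x-projections meet iff \<open>t' - t \<le> s\<close> and
  the y-projections iff \<open>t' - t \<le> s'\<close>; together they give the minimum.\<close>

lemma grounded_box_Int:
  assumes "0 \<le> s" "l \<le> u" "0 \<le> s'" "l' \<le> u'"
  shows "grounded_box t s l u \<inter> grounded_box t' s' l' u' \<noteq> {} \<longleftrightarrow>
    \<bar>t - t'\<bar> \<le> min s s' \<and> l \<le> u' \<and> l' \<le> u"
proof -
  have "grounded_box t s l u \<inter> grounded_box t' s' l' u' =
    {max t t'..min (t + s) (t' + s')} \<times> {max (t - s) (t' - s')..min t t'} \<times> {max l l'..min u u'}"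
    unfolding grounded_box_def by (simp add: Times_Int_Times Int_atLeastAtMost)
  then show ?thesis using assms by auto
qed

text \<open>A box meets the plane \<open>x = y\<close> only above \<open>(t, t)\<close>. Distinct
  positions thus give distinct sets, so no vertices merge in the intersection graph.\<close>

lemma grounded_box_inject:
  assumes "0 \<le> s" "l \<le> u" "0 \<le> s'" "l' \<le> u'" "grounded_box t s l u = grounded_box t' s' l' u'"
  shows "t = t'"
proof -
  have "(t, t, l) \<in> grounded_box t s l u" "(t', t', l') \<in> grounded_box t' s' l' u'"
    using assms(1-4) unfolding grounded_box_def by auto
  then have "(t, t, l) \<in> grounded_box t' s' l' u'" "(t', t', l') \<in> grounded_box t s l u"
    using assms(5) by auto
  then show ?thesis unfolding grounded_box_def by auto
qed

theorem theorem5: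
  fixes g k :: nat
  assumes "g \<ge> 3" and "k \<ge> 1"
  shows "\<exists>G. grounded_square_box_graph G \<and> girth G \<ge> enat g \<and> chromatic_number G \<ge> enat k"
proof -
  obtain V :: "real set" and s l u where S: "box_system g k V (\<lambda>x. x) s l u"
    using box_system_exists by blast
  let ?adj = "touch (\<lambda>x. x) s l u"
  have V: "finite V" "\<And>x. x \<in> V \<Longrightarrow> 0 \<le> s x" "\<And>x. x \<in> V \<Longrightarrow> l x \<le> u x"
    "locally_sparse g V ?adj" "uncolorable k V ?adj"
    using S unfolding box_system_def by (auto simp: less_imp_le)
  define b where "b x = grounded_box x (s x) (l x) (u x)" for x
  let ?G = "intersection_graph (b ` V)"
  have b_inj: "x = y" if "b x = b y" "x \<in> V" "y \<in> V" for x y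
    using grounded_box_inject[of "s x" "l x" "u x" "s y" "l y" "u y" x y] that V(2,3)
    unfolding b_def by simp
  have edge: "{b x, b y} \<in> edges ?G \<longleftrightarrow> ?adj x y" if "x \<in> V" "y \<in> V" for x y
  proof -
    have "{b x, b y} \<in> edges ?G \<longleftrightarrow> b x \<noteq> b y \<and> b x \<inter> b y \<noteq> {}"
      using that unfolding intersection_graph_def by (auto simp: doubleton_eq_iff)
    also have "\<dots> \<longleftrightarrow> ?adj x y"
      using b_inj[OF _ that] grounded_box_Int[of "s x" "l x" "u x" "s y" "l y" "u y" x y] that V(2,3)
      unfolding b_def touch_def by auto
    finally show ?thesis .
  qed
  have verts: "verts ?G = b ` V" unfolding intersection_graph_def by simp
  have "grounded_square_box_graph ?G"
    unfolding grounded_square_box_graph_def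
    by (rule exI[of _ "b ` V"]) (use V(1-3) in \<open>auto simp: b_def intro: grounded_square_box_grounded_box\<close>)
  moreover have "enat g \<le> girth ?G"
    unfolding girth_def
  proof (rule INF_greatest)
    fix vs assume "vs \<in> {vs. is_cycle ?G vs}"
    then have vs: "3 \<le> length vs" "distinct vs" "set vs \<subseteq> b ` V"
      and cyc: "\<And>i. i < length vs \<Longrightarrow> {vs ! i, vs ! (Suc i mod length vs)} \<in> edges ?G"
      unfolding is_cycle_def verts by auto
    show "enat g \<le> enat (length vs)"
    proof (rule ccontr)
      assume "\<not> ?thesis"
      then have len: "length vs < g" by simp
      have "vs \<in> map b ` lists V" using vs(3) unfolding lists_image[symmetric] by auto
      then obtain ws where ws: "set ws \<subseteq> V" "vs = map b ws" by auto
      let ?n = "length ws"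
      have n: "?n = length vs" "?n \<ge> 3" using ws vs(1) by auto
      have dist: "distinct ws" using vs(2) unfolding ws(2) by (simp add: distinct_map)
      have step: "?adj (ws ! i) (ws ! (Suc i mod ?n))" if "i < ?n" for i
      proof -
        have i': "Suc i mod ?n < ?n" using that by (intro mod_less_divisor) linarith
        then have "{b (ws ! i), b (ws ! (Suc i mod ?n))} \<in> edges ?G"
          using cyc[of i] that unfolding ws(2) by simp
        then show ?thesis using edge ws(1) that i' by (meson nth_mem subsetD)
      qed
      have "set ws \<noteq> {}" using n by auto
      moreover have "card (set ws) < g" using len n dist by (simp add: distinct_card)
      ultimately obtain w p where w: "w \<in> set ws" "\<forall>y\<in>set ws. ?adj w y \<longrightarrow> y = p"
        using V(4) ws(1) unfolding locally_sparse_def by (meson finite_set)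
      obtain i where i: "i < ?n" "w = ws ! i" using w(1) by (metis in_set_conv_nth)
      \<comment> \<open>\<open>j\<close> is the cyclic predecessor of \<open>i\<close>. At a leaf it
        would coincide with the successor, which is impossible for length at least 3.\<close>
      define j where "j = (if i = 0 then ?n - 1 else i - 1)"
      have j: "j < ?n" "Suc j mod ?n = i" using i(1) unfolding j_def by auto
      have i': "Suc i mod ?n < ?n" using i(1) by (intro mod_less_divisor) linarith
      have "ws ! (Suc i mod ?n) = p" using step[OF i(1)] w(2) i i' by simp
      moreover have "?adj w (ws ! j)" using step[OF j(1)] j(2) i(2) touch_sym by metis
      then have "ws ! j = p" using w(2) j(1) by simp
      ultimately have "Suc i mod ?n = j" using dist i' j(1) nth_eq_iff_index_eq by metis
      then show False using i(1) n(2) unfolding j_def by (auto simp: mod_Suc split: if_splits)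
    qed
  qed
  moreover have "enat k \<le> chromatic_number ?G"
    unfolding chromatic_number_def
  proof (rule INF_greatest)
    fix n assume "n \<in> {n. \<exists>c. proper_coloring ?G n c}"
    then obtain c where c: "proper_coloring ?G n c" by blast
    show "enat k \<le> enat n"
    proof (rule ccontr)
      assume "\<not> ?thesis"
      then have "n < k" by simp
      then have "\<forall>x\<in>V. (c \<circ> b) x < k" using c unfolding proper_coloring_def verts by fastforce
      then obtain x y where xy: "x \<in> V" "y \<in> V" "?adj x y" "(c \<circ> b) x = (c \<circ> b) y"
        using V(5) unfolding uncolorable_def by blast
      then show False using c edge unfolding proper_coloring_def verts by auto
    qed
  qed
  ultimately show ?thesis by blast
qed

end
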